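(* Let $d\ge1$, $2\le p<\infty$, let $\mathcal{O}\subset\mathbb{R}^d$ be a bounded smooth domain, and let $\lambda>0$. Then there exists at most one (positive, classical) solution $u$ of the constrained stationary problem $$\Delta u-u^{p-1}+\lambda u=0\ \text{ in }\mathcal{O},\qquad u>0\ \text{ in }\mathcal{O},\qquad u=0\ \text{ on }\partial\mathcal{O},\qquad \int_{\mathcal{O}}|u(x)|^2dx=1.$$
   Context: A classical solution is a function $u\in C^2(\mathcal{O})\cap C(\overline{\mathcal{O}})$ satisfying the equation and boundary condition pointwise. *)

theory Defs
  imports "HOL-Analysis.Analysis"
begin

text \<open>
  The Euclidean space is an arbitrary type of class \<open>euclidean_space\<close>; its dimension is a positive
  natural number, and \<open>Basis\<close> is its orthonormal basis of coordinate directions.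
\<close>

definition partial :: "'a::euclidean_space \<Rightarrow> ('a \<Rightarrow> real) \<Rightarrow> 'a \<Rightarrow> real" where
  "partial b f x = frechet_derivative f (at x) b"

text \<open>
  \<open>C_on k S f\<close> is meant for open \<open>S\<close>. The values of \<open>partial\<close> are junk at points where \<open>f\<close> is not
  differentiable, so differentiability is required explicitly at each stage.
\<close>

fun C_on :: "nat \<Rightarrow> 'a::euclidean_space set \<Rightarrow> ('a \<Rightarrow> real) \<Rightarrow> bool" where
  "C_on 0 S f \<longleftrightarrow> continuous_on S f"
| "C_on (Suc k) S f \<longleftrightarrow>
     (\<forall>x\<in>S. f differentiable (at x)) \<and> (\<forall>b\<in>Basis. C_on k S (partial b f))"

definition smooth_on :: "'a::euclidean_space set \<Rightarrow> ('a \<Rightarrow> real) \<Rightarrow> bool" where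
  "smooth_on S f \<longleftrightarrow> (\<forall>k. C_on k S f)"

definition laplacian :: "('a::euclidean_space \<Rightarrow> real) \<Rightarrow> 'a \<Rightarrow> real" where
  "laplacian f x = (\<Sum>b\<in>Basis. partial b (partial b f) x)"

text \<open>
  The boundary is smooth if near each of its points the set is the sublevel set of a smooth local
  defining function without critical points (equivalently, by the implicit function theorem, the
  set lies locally on one side of the graph of a smooth function).
\<close>

definition smooth_boundary :: "'a::euclidean_space set \<Rightarrow> bool" where
  "smooth_boundary D \<longleftrightarrow>
     (\<forall>z\<in>frontier D. \<exists>U \<rho>. open U \<and> z \<in> U \<and> smooth_on U \<rho> \<and>
        (\<forall>x\<in>U. \<exists>b\<in>Basis. partial b \<rho> x \<noteq> 0) \<and> D \<inter> U = {x\<in>U. \<rho> x < 0} \<and>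
        frontier D \<inter> U = {x\<in>U. \<rho> x = 0})"

definition bounded_smooth_domain :: "'a::euclidean_space set \<Rightarrow> bool" where
  "bounded_smooth_domain D \<longleftrightarrow>
     open D \<and> connected D \<and> D \<noteq> {} \<and> bounded D \<and> smooth_boundary D"

text \<open>
  Only the values of \<open>u\<close> on \<open>closure D\<close> matter. The exponent is real, and \<open>powr\<close> is applied to
  positive numbers only. The integrand is continuous and bounded on the bounded open set \<open>D\<close>, so the
  Lebesgue integral never takes its default value.
\<close>

definition positive_classical_solution ::
    "'a::euclidean_space set \<Rightarrow> real \<Rightarrow> real \<Rightarrow> ('a \<Rightarrow> real) \<Rightarrow> bool" where
  "positive_classical_solution D p lam u \<longleftrightarrow>
     C_on 2 D u \<and> continuous_on (closure D) u \<and>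
     (\<forall>x\<in>D. laplacian u x - u x powr (p - 1) + lam * u x = 0) \<and>
     (\<forall>x\<in>D. u x > 0) \<and>
     (\<forall>x\<in>frontier D. u x = 0) \<and>
     (LINT x:D|lborel. \<bar>u x\<bar>\<^sup>2) = 1"

end

theory Submission
  imports Defs
begin

text \<open>
  Let \<open>t\<close> be the least number \<open>\<ge> 1\<close> with \<open>u \<le> t v\<close> in \<open>D\<close>. The function
  \<open>z = t v - u \<ge> 0\<close> satisfies \<open>\<Delta> z \<le> C z\<close>, so by the strong maximum principle it is identically
  zero or positive. In the first case the two normalizations give \<open>t = 1\<close>. In the second case \<open>t\<close>
  can be decreased on the compact set of points at distance at least \<open>\<delta>\<close> from the boundary, and a
  maximum principle in the remaining boundary strip carries the inequality over to all of \<open>D\<close>, so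
  again \<open>t = 1\<close>. Hence \<open>u \<le> v\<close>, and the roles of \<open>u\<close> and \<open>v\<close> can be exchanged. The
  maximum principle holds in a thin strip although the zeroth order term has the wrong sign there,
  and it makes the Hopf boundary lemma and any regularity up to the boundary unnecessary.
\<close>

section \<open>Derivatives along coordinate lines\<close>

text \<open>A relation about a function of one real variable: sums, products and barriers are then
  differentiated by one-variable rules, without computing Frechet derivatives.\<close>

definition has_partial :: "'a::euclidean_space \<Rightarrow> ('a \<Rightarrow> real) \<Rightarrow> real \<Rightarrow> 'a \<Rightarrow> bool" where
  "has_partial b f c x \<longleftrightarrow> ((\<lambda>s. f (x + s *\<^sub>R b)) has_real_derivative c) (at 0)"

text \<open>Only the pure second derivatives are recorded, since their sum is the Laplacian. Both
  derivatives are explicit arguments, so that those of a barrier can be given by formulas.\<close>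

definition has_second_partials ::
    "'a::euclidean_space set \<Rightarrow> ('a \<Rightarrow> real) \<Rightarrow> ('a \<Rightarrow> 'a \<Rightarrow> real) \<Rightarrow> ('a \<Rightarrow> 'a \<Rightarrow> real) \<Rightarrow> bool" where
  "has_second_partials S f f1 f2 \<longleftrightarrow>
     (\<forall>b\<in>Basis. \<forall>x\<in>S. has_partial b f (f1 b x) x \<and> has_partial b (f1 b) (f2 b x) x)"

lemma has_partial_shift:
  assumes "has_partial b f c (x + s *\<^sub>R b)"
  shows "((\<lambda>s. f (x + s *\<^sub>R b)) has_real_derivative c) (at s)"
proof -
  have "((\<lambda>h. f (x + (h + s) *\<^sub>R b)) has_real_derivative c) (at 0)"
    using assms by (simp add: has_partial_def algebra_simps)
  then show ?thesis
    using DERIV_shift[of "\<lambda>s. f (x + s *\<^sub>R b)" c 0 s] by simp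
qed

lemma has_partial_diff:
  "has_partial b f c x \<Longrightarrow> has_partial b g d x \<Longrightarrow> has_partial b (\<lambda>x. f x - g x) (c - d) x"
  unfolding has_partial_def by (rule DERIV_diff)

lemma has_partial_add:
  "has_partial b f c x \<Longrightarrow> has_partial b g d x \<Longrightarrow> has_partial b (\<lambda>x. f x + g x) (c + d) x"
  unfolding has_partial_def by (rule DERIV_add)

lemma has_partial_cmult:
  "has_partial b f c x \<Longrightarrow> has_partial b (\<lambda>x. k * f x) (k * c) x"
  unfolding has_partial_def by (rule DERIV_cmult)

lemma has_partial_mult:
  "has_partial b f c x \<Longrightarrow> has_partial b g d x \<Longrightarrow>
    has_partial b (\<lambda>x. f x * g x) (c * g x + d * f x) x"
  unfolding has_partial_def by (drule (1) DERIV_mult) simp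

lemma has_partial_const: "has_partial b (\<lambda>x. k) 0 x"
  unfolding has_partial_def by simp

lemma has_partial_exp:
  "has_partial b f c x \<Longrightarrow> has_partial b (\<lambda>x. exp (f x)) (exp (f x) * c) x"
  unfolding has_partial_def by (drule DERIV_fun_exp) simp

lemma has_partial_inner:
  assumes "b \<in> Basis"
  shows "has_partial b (\<lambda>x. (x - a) \<bullet> b) 1 x"
proof -
  have "(\<lambda>s. (x + s *\<^sub>R b - a) \<bullet> b) = (\<lambda>s. (x - a) \<bullet> b + s)"
    using assms by (auto simp: inner_simps inner_Basis)
  then show ?thesis
    unfolding has_partial_def by (auto intro!: derivative_eq_intros)
qed

lemma has_partial_norm_square:
  assumes "b \<in> Basis"
  shows "has_partial b (\<lambda>x. (norm (x - a))\<^sup>2) (2 * ((x - a) \<bullet> b)) x"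
proof -
  have "(\<lambda>s. (norm (x + s *\<^sub>R b - a))\<^sup>2) = (\<lambda>s. (norm (x - a))\<^sup>2 + 2 * s * ((x - a) \<bullet> b) + s\<^sup>2)"
    using assms
    unfolding power2_norm_eq_inner
    by (simp add: fun_eq_iff inner_simps inner_commute power2_eq_square algebra_simps
        del: dot_square_norm)
  then show ?thesis
    unfolding has_partial_def by (auto intro!: derivative_eq_intros)
qed

lemma has_second_partials_diff:
  assumes "has_second_partials S f f1 f2" "has_second_partials S g g1 g2"
  shows "has_second_partials S (\<lambda>x. f x - g x) (\<lambda>b x. f1 b x - g1 b x) (\<lambda>b x. f2 b x - g2 b x)"
  using assms unfolding has_second_partials_def by (blast intro: has_partial_diff)

lemma has_second_partials_cmult:
  assumes "has_second_partials S f f1 f2"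
  shows "has_second_partials S (\<lambda>x. k * f x) (\<lambda>b x. k * f1 b x) (\<lambda>b x. k * f2 b x)"
  using assms unfolding has_second_partials_def by (blast intro: has_partial_cmult)

lemma has_second_partials_subset:
  "has_second_partials S f f1 f2 \<Longrightarrow> T \<subseteq> S \<Longrightarrow> has_second_partials T f f1 f2"
  unfolding has_second_partials_def by blast

text \<open>The chain rule along the line through \<open>x\<close> in direction \<open>b\<close>
  links the Frechet-based \<open>partial\<close> to \<open>has_partial\<close>.\<close>

lemma has_partial_partial:
  assumes "f differentiable (at x)"
  shows "has_partial b f (partial b f x) x"
proof -
  have f: "(f has_derivative frechet_derivative f (at x)) (at (x + 0 *\<^sub>R b))"
    using assms frechet_derivative_works by auto
  have l: "((\<lambda>s. x + s *\<^sub>R b) has_derivative (\<lambda>s. s *\<^sub>R b)) (at 0)"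
    by (auto intro!: derivative_eq_intros)
  have "((\<lambda>s. f (x + s *\<^sub>R b)) has_derivative (\<lambda>s. frechet_derivative f (at x) (s *\<^sub>R b))) (at 0)"
    using has_derivative_compose[OF l f] .
  moreover have "(\<lambda>s. frechet_derivative f (at x) (s *\<^sub>R b)) = (*) (partial b f x)"
    using linear_frechet_derivative[OF assms]
    by (simp add: partial_def linear_scale fun_eq_iff mult.commute)
  ultimately show ?thesis
    by (simp add: has_partial_def has_field_derivative_def)
qed

lemma C_on_2_has_second_partials:
  assumes "C_on 2 S f"
  shows "has_second_partials S f (\<lambda>b. partial b f) (\<lambda>b. partial b (partial b f))"
  using assms unfolding has_second_partials_def
  by (auto simp: numeral_2_eq_2 intro: has_partial_partial)

section \<open>Second-order conditions at a maximum\<close>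

text \<open>If \<open>c\<close> were positive, \<open>f1\<close> would exceed
  \<open>f1 0 = 0\<close> just to the right of \<open>0\<close>, and the mean value theorem would
  give \<open>f h > f 0\<close>. Continuity of the second derivative does not enter.\<close>

lemma second_derivative_nonpos_at_max:
  fixes f f1 :: "real \<Rightarrow> real"
  assumes "e > 0"
    and f: "\<And>s. \<bar>s\<bar> < e \<Longrightarrow> (f has_real_derivative f1 s) (at s)"
    and f1: "(f1 has_real_derivative c) (at 0)"
    and max: "\<And>s. \<bar>s\<bar> < e \<Longrightarrow> f s \<le> f 0"
  shows "c \<le> 0"
proof (rule ccontr)
  assume "\<not> c \<le> 0"
  then obtain d where d: "d > 0" "\<And>h. h > 0 \<Longrightarrow> h < d \<Longrightarrow> f1 0 < f1 (0 + h)"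
    using DERIV_pos_inc_right[OF f1] by auto
  have z: "f1 0 = 0"
    using DERIV_local_max[OF f[of 0] \<open>e > 0\<close>] max \<open>e > 0\<close> by auto
  define h where "h = min d e / 2"
  have h: "h > 0" "h < d" "h < e"
    using \<open>e > 0\<close> d(1) by (auto simp: h_def min_def)
  obtain y where y: "0 < y" "y < h" "f h - f 0 = (h - 0) * f1 y"
    using MVT2[of 0 h f f1] f h by (metis abs_of_nonneg le_less_trans)
  have "f1 y > 0"
    using d(2)[of y] y h z by simp
  then have "f h > f 0"
    using y h by (simp add: algebra_simps)
  then show False
    using max[of h] h by simp
qed

lemma second_partial_nonpos_at_max:
  assumes "has_second_partials S f f1 f2" "open S" "x \<in> S" "b \<in> Basis"
    and max: "\<And>y. y \<in> S \<Longrightarrow> f y \<le> f x"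
  shows "f2 b x \<le> 0"
proof -
  obtain e where e: "e > 0" "ball x e \<subseteq> S"
    using assms(2,3) open_contains_ball by blast
  have S: "x + s *\<^sub>R b \<in> S" if "\<bar>s\<bar> < e" for s
    using that e(2) assms(4) by (auto simp: subset_eq dist_norm)
  show ?thesis
  proof (rule second_derivative_nonpos_at_max[of e "\<lambda>s. f (x + s *\<^sub>R b)" "\<lambda>s. f1 b (x + s *\<^sub>R b)"])
    show "((\<lambda>s. f (x + s *\<^sub>R b)) has_real_derivative f1 b (x + s *\<^sub>R b)) (at s)" if "\<bar>s\<bar> < e" for s
      using S[OF that] assms(1,4) unfolding has_second_partials_def
      by (intro has_partial_shift) auto
    show "((\<lambda>s. f1 b (x + s *\<^sub>R b)) has_real_derivative f2 b x) (at 0)"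
      using assms(1,3,4) unfolding has_second_partials_def has_partial_def by auto
  qed (use e S max in auto)
qed

text \<open>The form in which all barrier comparisons are made: the test above is applied to
  \<open>f - g\<close> in each coordinate direction and summed.\<close>

lemma second_partials_sum_le_at_max:
  assumes "has_second_partials S f f1 f2" "has_second_partials S g g1 g2" "open S" "x \<in> S"
    and "\<And>y. y \<in> S \<Longrightarrow> f y - g y \<le> f x - g x"
  shows "(\<Sum>b\<in>Basis. f2 b x) \<le> (\<Sum>b\<in>Basis. g2 b x)"
proof (rule sum_mono)
  fix b :: 'a assume "b \<in> Basis"
  then show "f2 b x \<le> g2 b x"
    using second_partial_nonpos_at_max[OF has_second_partials_diff[OF assms(1,2)] assms(3,4) _ assms(5)]
    by simp
qed

section \<open>Derivatives of the two barriers\<close>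

lemma sum_inner_Basis_square: "(\<Sum>b\<in>Basis. (x \<bullet> b)\<^sup>2) = (norm x)\<^sup>2"
  unfolding power2_norm_eq_inner by (simp only: power2_eq_square euclidean_inner[of x x])

text \<open>Squaring \<open>\<rho>\<close> produces a term of definite sign: the squares
  \<open>(\<rho>1 b x)\<^sup>2\<close> add up to the squared gradient, while the other term carries
  a factor \<open>\<rho> x\<close>, small near the zero set.\<close>

lemma barrier_second_partials:
  assumes "has_second_partials S \<rho> \<rho>1 \<rho>2"
  shows "has_second_partials S (\<lambda>x. M * (1 + c * (norm (x - a))\<^sup>2 - K * (\<rho> x * \<rho> x)))
    (\<lambda>b x. M * (c * (2 * ((x - a) \<bullet> b)) - K * (2 * (\<rho>1 b x * \<rho> x))))
    (\<lambda>b x. M * (2 * c - 2 * K * ((\<rho>1 b x)\<^sup>2 + \<rho> x * \<rho>2 b x)))"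
  unfolding has_second_partials_def
proof (intro ballI conjI)
  fix b x :: 'a assume b: "b \<in> Basis" and x: "x \<in> S"
  have \<rho>: "has_partial b \<rho> (\<rho>1 b x) x" "has_partial b (\<rho>1 b) (\<rho>2 b x) x"
    using assms b x by (auto simp: has_second_partials_def)
  have "has_partial b (\<lambda>x. M * (1 + c * (norm (x - a))\<^sup>2 - K * (\<rho> x * \<rho> x)))
      (M * (0 + c * (2 * ((x - a) \<bullet> b)) - K * (\<rho>1 b x * \<rho> x + \<rho>1 b x * \<rho> x))) x"
    by (intro has_partial_cmult has_partial_diff has_partial_add has_partial_const
        has_partial_norm_square has_partial_mult b \<rho>)
  then show "has_partial b (\<lambda>x. M * (1 + c * (norm (x - a))\<^sup>2 - K * (\<rho> x * \<rho> x)))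
      (M * (c * (2 * ((x - a) \<bullet> b)) - K * (2 * (\<rho>1 b x * \<rho> x)))) x"
    by (simp only: mult_2 add_0_left)
  have "has_partial b (\<lambda>x. M * (c * (2 * ((x - a) \<bullet> b)) - K * (2 * (\<rho>1 b x * \<rho> x))))
      (M * (c * (2 * 1) - K * (2 * (\<rho>2 b x * \<rho> x + \<rho>1 b x * \<rho>1 b x)))) x"
    by (intro has_partial_cmult has_partial_diff has_partial_inner has_partial_mult b \<rho>)
  then show "has_partial b (\<lambda>x. M * (c * (2 * ((x - a) \<bullet> b)) - K * (2 * (\<rho>1 b x * \<rho> x))))
      (M * (2 * c - 2 * K * ((\<rho>1 b x)\<^sup>2 + \<rho> x * \<rho>2 b x))) x"
    by (simp add: power2_eq_square algebra_simps)
qed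

text \<open>The shift \<open>q\<close> makes the function vanish on a chosen sphere around
  \<open>a\<close>. For large \<open>\<alpha>\<close> the quadratic term dominates the summed second
  derivatives away from \<open>a\<close>.\<close>

lemma gaussian_second_partials:
  "has_second_partials S (\<lambda>x. k * (exp (- \<alpha> * (norm (x - a))\<^sup>2) - q))
    (\<lambda>b x. k * (exp (- \<alpha> * (norm (x - a))\<^sup>2) * (- \<alpha> * (2 * ((x - a) \<bullet> b)))))
    (\<lambda>b x. k * (exp (- \<alpha> * (norm (x - a))\<^sup>2) * (4 * \<alpha>\<^sup>2 * ((x - a) \<bullet> b)\<^sup>2 - 2 * \<alpha>)))"
  unfolding has_second_partials_def
proof (intro ballI conjI)
  fix b x :: 'a assume b: "b \<in> Basis"
  let ?E = "\<lambda>x. exp (- \<alpha> * (norm (x - a))\<^sup>2)"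
  have E: "has_partial b ?E (?E x * (- \<alpha> * (2 * ((x - a) \<bullet> b)))) x"
    by (intro has_partial_exp has_partial_cmult has_partial_norm_square b)
  have "has_partial b (\<lambda>x. k * (?E x - q)) (k * (?E x * (- \<alpha> * (2 * ((x - a) \<bullet> b))) - 0)) x"
    by (intro has_partial_cmult has_partial_diff has_partial_const E)
  then show "has_partial b (\<lambda>x. k * (?E x - q)) (k * (?E x * (- \<alpha> * (2 * ((x - a) \<bullet> b))))) x"
    by simp
  have "has_partial b (\<lambda>x. k * (?E x * (- \<alpha> * (2 * ((x - a) \<bullet> b)))))
    (k * ((?E x * (- \<alpha> * (2 * ((x - a) \<bullet> b)))) * (- \<alpha> * (2 * ((x - a) \<bullet> b))) + (- \<alpha> * (2 * 1)) * ?E x)) x"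
    by (intro has_partial_cmult has_partial_mult E has_partial_inner b)
  then show "has_partial b (\<lambda>x. k * (?E x * (- \<alpha> * (2 * ((x - a) \<bullet> b)))))
    (k * (?E x * (4 * \<alpha>\<^sup>2 * ((x - a) \<bullet> b)\<^sup>2 - 2 * \<alpha>))) x"
    by (simp add: power2_eq_square algebra_simps)
qed

section \<open>Maximum principle in a thin boundary strip\<close>

lemma C_on_2_imp_continuous_on:
  assumes "C_on 2 S f"
  shows "continuous_on S f"
    and "b \<in> Basis \<Longrightarrow> continuous_on S (partial b f)"
    and "b \<in> Basis \<Longrightarrow> continuous_on S (partial b (partial b f))"
  using assms
  by (auto simp: numeral_2_eq_2 intro!: continuous_at_imp_continuous_on
      differentiable_imp_continuous_within)

lemma infdist_attained_on_frontier:
  fixes D :: "'a::euclidean_space set"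
  assumes "frontier D \<noteq> {}"
  obtains y where "y \<in> frontier D" "infdist x (frontier D) = dist x y"
  using infdist_attains_inf[OF _ assms, of x] by (metis frontier_closed)

text \<open>Meant for \<open>z = u - t v\<close>. The zeroth order term has the sign for which a
  maximum principle may fail on large sets, so \<open>z\<close> is assumed nonpositive at distance
  at least \<open>\<delta>\<close> from the boundary; the differential inequality is asked only
  where \<open>z\<close> is positive.\<close>

definition strip_subsolution :: "'a::euclidean_space set \<Rightarrow> real \<Rightarrow> real \<Rightarrow> ('a \<Rightarrow> real) \<Rightarrow> bool" where
  "strip_subsolution D lam \<delta> z \<longleftrightarrow>
     continuous_on (closure D) z \<and> (\<forall>x\<in>frontier D. z x \<le> 0) \<and>
     (\<forall>x\<in>D. infdist x (frontier D) \<ge> \<delta> \<longrightarrow> z x \<le> 0) \<and>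
     (\<exists>z1 z2. has_second_partials D z z1 z2 \<and>
        (\<forall>x\<in>D. z x > 0 \<longrightarrow> (\<Sum>b\<in>Basis. z2 b x) \<ge> - lam * z x))"

text \<open>
  Near \<open>z0\<close> with local defining function \<open>\<rho>\<close>, compare \<open>z\<close> with the multiple \<open>z x0\<close> of the barrier
  \<open>1 + |x - x0|\<^sup>2 / r\<^sup>2 - K \<rho>\<^sup>2\<close>: for large \<open>K\<close> the term \<open>-2 K |\<nabla>\<rho>|\<^sup>2\<close> dominates its Laplacian,
  while \<open>K \<rho>\<^sup>2\<close> itself is at most \<open>1/2\<close> in a thin strip.
\<close>

lemma strip_subsolution_max_away:
  fixes D :: "'a::euclidean_space set"
  assumes D: "open D" "smooth_boundary D" and z0: "z0 \<in> frontier D" and lam: "lam \<ge> 0"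
  obtains \<delta> where "\<delta> > 0"
    "\<And>\<delta>' z x0. \<delta>' \<le> \<delta> \<Longrightarrow> strip_subsolution D lam \<delta>' z \<Longrightarrow> x0 \<in> D \<Longrightarrow> z x0 > 0 \<Longrightarrow>
       (\<forall>x\<in>D. z x \<le> z x0) \<Longrightarrow> dist x0 z0 \<ge> \<delta>"
proof -
  let ?F = "frontier D"
  obtain U \<rho> where U: "open U" "z0 \<in> U" and sm: "smooth_on U \<rho>"
    and grad: "\<forall>x\<in>U. \<exists>b\<in>Basis. partial b \<rho> x \<noteq> 0"
    and F: "?F \<inter> U = {x\<in>U. \<rho> x = 0}"
    using D(2) z0 unfolding smooth_boundary_def by meson
  have C2: "C_on 2 U \<rho>"
    using sm by (simp add: smooth_on_def)
  obtain r' where "r' > 0" "cball z0 r' \<subseteq> U"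
    using U open_contains_cball by blast
  \<comment> \<open>The radius \<open>3 * r\<close> leaves room for three steps of length at most
    \<open>r\<close>: from \<open>z0\<close> to \<open>x0\<close>, from \<open>x0\<close> to a point
    of \<open>A\<close>, and from there to a nearest boundary point.\<close>
  then obtain r where r: "r > 0" "cball z0 (3 * r) \<subseteq> U"
    by (metis mult.commute nonzero_eq_divide_eq zero_less_divide_iff zero_less_numeral
        zero_neq_numeral)
  let ?B = "cball z0 (3 * r)"
  let ?G = "\<lambda>x. \<Sum>b\<in>Basis. (partial b \<rho> x)\<^sup>2"
  let ?L = "\<lambda>x. \<Sum>b\<in>Basis. partial b (partial b \<rho>) x"
  have cG: "continuous_on ?B ?G" and cL: "continuous_on ?B ?L" and c\<rho>: "continuous_on ?B \<rho>"
    using C_on_2_imp_continuous_on[OF C2] r(2)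
    by (auto intro!: continuous_intros intro: continuous_on_subset)
  have zB: "z0 \<in> ?B"
    using r(1) by simp
  obtain xm where xm: "xm \<in> ?B" "\<And>x. x \<in> ?B \<Longrightarrow> ?G xm \<le> ?G x"
    using continuous_attains_inf[OF compact_cball _ cG] zB by auto
  define m where "m = ?G xm"
  have m: "m > 0"
  proof -
    obtain b where b: "b \<in> Basis" "partial b \<rho> xm \<noteq> 0"
      using grad xm(1) r(2) by blast
    have "(partial b \<rho> xm)\<^sup>2 \<le> ?G xm"
      using b(1) by (intro member_le_sum) auto
    then show ?thesis
      using b(2) by (simp add: m_def) (smt (verit) zero_less_power2)
  qed
  obtain x' where x': "\<And>x. x \<in> ?B \<Longrightarrow> \<bar>?L x\<bar> \<le> \<bar>?L x'\<bar>"
    using continuous_attains_sup[OF compact_cball _ continuous_on_rabs[OF cL]] zB by blast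
  obtain Mb where Mb: "Mb \<ge> 0" "\<And>x. x \<in> ?B \<Longrightarrow> \<bar>?L x\<bar> \<le> Mb"
    using x' that[of "\<bar>?L x'\<bar>"] by simp
  define d where "d = real DIM('a)"
  \<comment> \<open>Chosen so that \<open>2 * d / r\<^sup>2 - K * m = - (lam + 1)\<close>, which
    beats \<open>- lam\<close>.\<close>
  define K where "K = (2 * d / r\<^sup>2 + lam + 1) / m"
  have K: "K > 0"
    using m lam by (auto simp: K_def d_def intro!: divide_pos_pos add_nonneg_pos add_nonneg_nonneg)
  \<comment> \<open>The bound \<open>1\<close> gives \<open>\<rho>\<^sup>2 \<le> e\<close>, the
    second keeps \<open>K \<rho>\<^sup>2\<close> below \<open>1/2\<close>, and the third lets
    \<open>\<rho>\<close> times its Laplacian consume at most half of the gradient term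
    \<open>m\<close>.\<close>
  define e where "e = min 1 (min (1 / (2 * K)) (m / (2 * (Mb + 1))))"
  have e: "e > 0" "e \<le> 1" "K * e \<le> 1/2" "e * Mb \<le> m / 2"
  proof -
    show "e > 0" "e \<le> 1"
      using K m Mb by (auto simp: e_def)
    have "e \<le> 1 / (2 * K)" by (simp add: e_def)
    then show "K * e \<le> 1/2"
      using K by (simp add: field_simps)
    have "e * Mb \<le> e * (Mb + 1)" using \<open>e > 0\<close> by simp
    also have "e \<le> m / (2 * (Mb + 1))" by (simp add: e_def)
    then have "e * (Mb + 1) \<le> m / 2" using Mb(1) by (simp add: field_simps)
    finally show "e * Mb \<le> m / 2" .
  qed
  obtain \<delta>1 where \<delta>1: "\<delta>1 > 0"
    "\<And>x y. x \<in> ?B \<Longrightarrow> y \<in> ?B \<Longrightarrow> dist y x < \<delta>1 \<Longrightarrow> dist (\<rho> y) (\<rho> x) < e"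
    using compact_uniformly_continuous[OF c\<rho> compact_cball] e(1)
    unfolding uniformly_continuous_on_def by metis
  define \<delta> where "\<delta> = min (\<delta>1 / 2) r"
  show thesis
  proof (rule that[of \<delta>])
    show "\<delta> > 0" using \<delta>1 r by (simp add: \<delta>_def)
    fix \<delta>' z x0
    assume \<delta>': "\<delta>' \<le> \<delta>" and sub: "strip_subsolution D lam \<delta>' z" and x0: "x0 \<in> D" "z x0 > 0"
      and max: "\<forall>x\<in>D. z x \<le> z x0"
    obtain z1 z2 where z12: "has_second_partials D z z1 z2"
      and lap: "\<And>x. x \<in> D \<Longrightarrow> z x > 0 \<Longrightarrow> (\<Sum>b\<in>Basis. z2 b x) \<ge> - lam * z x"
      using sub unfolding strip_subsolution_def by blast
    have cz: "continuous_on (closure D) z" and zF: "\<And>x. x \<in> ?F \<Longrightarrow> z x \<le> 0"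
      and zs: "\<And>x. x \<in> D \<Longrightarrow> infdist x ?F \<ge> \<delta>' \<Longrightarrow> z x \<le> 0"
      using sub unfolding strip_subsolution_def by auto
    show "dist x0 z0 \<ge> \<delta>"
    proof (rule ccontr)
      assume "\<not> dist x0 z0 \<ge> \<delta>"
      then have x0z0: "dist x0 z0 < r" by (simp add: \<delta>_def)
      define A where "A = cball x0 r \<inter> closure D \<inter> {x. infdist x ?F \<le> \<delta>'}"
      have cinf: "continuous_on UNIV (\<lambda>x. infdist x ?F)"
        by (intro continuous_on_infdist continuous_on_id)
      have Acomp: "compact A"
        unfolding A_def
        by (intro compact_Int_closed compact_cball closed_closure closed_Collect_le cinf
            continuous_on_const)
      have AB: "A \<subseteq> ?B"
      proof
        fix x assume "x \<in> A"
        then have "dist x0 x \<le> r" by (simp add: A_def)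
        then show "x \<in> ?B"
          using dist_triangle[of z0 x x0] x0z0 r by (simp add: dist_commute)
      qed
      \<comment> \<open>A nearest boundary point is a zero of \<open>\<rho>\<close>, and it is close
        enough for the uniform continuity of \<open>\<rho>\<close> to apply.\<close>
      have small: "\<bar>\<rho> x\<bar> < e" if x: "x \<in> A" for x
      proof -
        obtain y where y: "y \<in> ?F" "infdist x ?F = dist x y"
          using infdist_attained_on_frontier z0 by blast
        have xy: "dist x y \<le> \<delta>"
          using x y \<delta>' by (simp add: A_def)
        have "dist z0 y \<le> dist z0 x0 + dist x0 x + dist x y"
          using dist_triangle[of z0 y x] dist_triangle[of z0 x x0] by simp
        then have yB: "y \<in> ?B"
          using x xy x0z0 by (simp add: A_def \<delta>_def dist_commute)
        then have "\<rho> y = 0"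
          using F y r(2) by blast
        moreover have "dist (\<rho> x) (\<rho> y) < e"
          using \<delta>1 yB AB x xy by (auto simp: \<delta>_def)
        ultimately show ?thesis by (simp add: dist_real_def)
      qed
      have K\<rho>: "K * (\<rho> x * \<rho> x) \<le> 1/2" if "x \<in> A" for x
      proof -
        have "\<rho> x * \<rho> x = \<bar>\<rho> x\<bar> * \<bar>\<rho> x\<bar>" by simp
        also have "\<dots> \<le> e * 1"
          using small[OF that] e by (intro mult_mono) auto
        finally have "K * (\<rho> x * \<rho> x) \<le> K * e" using K by simp
        then show ?thesis using e(3) by linarith
      qed
      define M where "M = z x0"
      have M: "M > 0" using x0 by (simp add: M_def)
      define w where "w = (\<lambda>x. M * (1 + (1 / r\<^sup>2) * (norm (x - x0))\<^sup>2 - K * (\<rho> x * \<rho> x)))"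
      have w: "w x \<ge> M * (1/2 + (1 / r\<^sup>2) * (norm (x - x0))\<^sup>2)" if "x \<in> A" for x
        unfolding w_def using K\<rho>[OF that] M by (intro mult_left_mono) auto
      have wpos: "w x > 0" if "x \<in> A" for x
      proof -
        have "0 < M * (1/2 + (1 / r\<^sup>2) * (norm (x - x0))\<^sup>2)"
          using M by (intro mult_pos_pos add_pos_nonneg) auto
        then show ?thesis using w[OF that] by linarith
      qed
      have cw: "continuous_on A w"
        unfolding w_def using continuous_on_subset[OF c\<rho> AB] by (intro continuous_intros)
      have czA: "continuous_on A z"
        using cz by (rule continuous_on_subset) (auto simp: A_def)
      have x0A: "x0 \<in> A"
        using x0 zs[of x0] r closure_subset by (force simp: A_def)
      obtain y where y: "y \<in> A" "\<And>x. x \<in> A \<Longrightarrow> z x - w x \<le> z y - w y"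
        using continuous_attains_sup[OF Acomp _ continuous_on_diff[OF czA cw]] x0A by auto
      \<comment> \<open>At its centre the barrier is at most \<open>M\<close>, so the maximum of
        \<open>z - w\<close> over \<open>A\<close> is nonnegative.\<close>
      have "z x0 - w x0 = M * (K * (\<rho> x0 * \<rho> x0))"
        by (simp add: w_def M_def algebra_simps)
      then have "z x0 - w x0 \<ge> 0" using M K by simp
      then have zwy: "z y \<ge> w y" using y(2)[OF x0A] by linarith
      then have zy: "z y > 0" using wpos[OF y(1)] by linarith
      \<comment> \<open>The maximum point lies on no part of the edge of \<open>A\<close>: on the
        frontier and at distance \<open>\<delta>'\<close> from it \<open>z\<close> is nonpositive,
        and on the sphere \<open>w\<close> is at least \<open>3/2 * M\<close> while
        \<open>z \<le> M\<close>.\<close>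
      then have "y \<notin> ?F" using zF[of y] by auto
      then have yD: "y \<in> D"
        using y(1) D(1) by (auto simp: A_def frontier_def interior_open)
      have yinf: "infdist y ?F < \<delta>'" using zs[OF yD] zy by force
      have "norm (y - x0) \<noteq> r"
      proof
        assume "norm (y - x0) = r"
        then have "w y \<ge> M * (1/2 + 1)" using w[OF y(1)] r by simp
        moreover have "z y \<le> M" using max yD by (simp add: M_def)
        ultimately show False using zwy M by simp
      qed
      then have yball: "y \<in> ball x0 r"
        using y(1) by (auto simp: A_def dist_norm norm_minus_commute)
      define S where "S = ball x0 r \<inter> D \<inter> {x. infdist x ?F < \<delta>'}"
      have S: "open S" "y \<in> S" "S \<subseteq> D" "S \<subseteq> A"
        unfolding S_def A_def using D(1) yball yD yinf closure_subset
        by (auto intro!: open_Int open_Collect_less cinf continuous_on_const)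
      have "(\<Sum>b\<in>Basis. z2 b y) \<le> (\<Sum>b\<in>Basis. M * (2 * (1 / r\<^sup>2) -
          2 * K * ((partial b \<rho> y)\<^sup>2 + \<rho> y * partial b (partial b \<rho>) y)))"
      proof (rule second_partials_sum_le_at_max[OF has_second_partials_subset[OF z12 S(3)] _ S(1,2)])
        show "has_second_partials S w (\<lambda>b x. M * ((1 / r\<^sup>2) * (2 * ((x - x0) \<bullet> b)) - K * (2 * (partial b \<rho> x * \<rho> x))))
          (\<lambda>b x. M * (2 * (1 / r\<^sup>2) - 2 * K * ((partial b \<rho> x)\<^sup>2 + \<rho> x * partial b (partial b \<rho>) x)))"
          unfolding w_def
          by (rule has_second_partials_subset[OF barrier_second_partials[OF C_on_2_has_second_partials[OF C2]]])
            (use S(4) AB r(2) in blast)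
        show "z x - w x \<le> z y - w y" if "x \<in> S" for x
          using y(2) that S(4) by blast
      qed
      also have "\<dots> = M * (2 * d / r\<^sup>2 - 2 * K * (?G y + \<rho> y * ?L y))"
        by (simp add: sum_distrib_left[symmetric] sum_subtractf sum.distrib d_def)
      also have "\<dots> \<le> M * (2 * d / r\<^sup>2 - 2 * K * (m / 2))"
      proof -
        have "\<bar>\<rho> y * ?L y\<bar> \<le> e * Mb"
          unfolding abs_mult using small[OF y(1)] Mb y(1) AB e by (intro mult_mono) auto
        then have "\<bar>\<rho> y * ?L y\<bar> \<le> m / 2" using e(4) by linarith
        moreover have "m \<le> ?G y" using xm(2) y(1) AB by (auto simp: m_def)
        ultimately have "m / 2 \<le> ?G y + \<rho> y * ?L y" by linarith
        then show ?thesis using M K by (intro mult_left_mono diff_left_mono) auto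
      qed
      also have "\<dots> = - (lam + 1) * M"
        using m by (simp add: K_def field_simps)
      also have "\<dots> < - lam * M"
        using M by (simp add: algebra_simps)
      also have "\<dots> \<le> - lam * z y"
        using max yD lam by (simp add: M_def mult_left_mono)
      also have "\<dots> \<le> (\<Sum>b\<in>Basis. z2 b y)"
        using lap[OF yD zy] .
      finally show False by simp
    qed
  qed
qed

text \<open>Compactness makes the local statement uniform. If every width failed, maximum points of
  counterexamples for the widths \<open>1 / Suc n\<close> would accumulate at a boundary point
  \<open>l\<close>, where \<open>strip_subsolution_max_away\<close> forbids them.\<close>

lemma strip_maximum_principle:
  fixes D :: "'a::euclidean_space set"
  assumes D: "bounded_smooth_domain D" and lam: "lam \<ge> 0"
  shows "\<exists>\<delta>>0. \<forall>z. strip_subsolution D lam \<delta> z \<longrightarrow> (\<forall>x\<in>D. z x \<le> 0)"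
proof (rule ccontr)
  assume neg: "\<not> ?thesis"
  have op: "open D" and bd: "bounded D" and ne: "D \<noteq> {}" and sb: "smooth_boundary D"
    using D by (auto simp: bounded_smooth_domain_def)
  let ?F = "frontier D"
  have Fne: "?F \<noteq> {}"
    using frontier_not_empty[OF ne] bd not_bounded_UNIV by blast
  have comp: "compact (closure D)"
    using bd by (simp add: compact_closure)
  \<comment> \<open>A positive value somewhere makes the maximum over the compact closure positive,
    hence attained off the frontier.\<close>
  have "\<exists>x z. strip_subsolution D lam (1 / real (Suc n)) z \<and> x \<in> D \<and> z x > 0 \<and> (\<forall>y\<in>D. z y \<le> z x)" for n
  proof -
    obtain z x where z: "strip_subsolution D lam (1 / real (Suc n)) z" "x \<in> D" "z x > 0"
      using neg by (metis not_le of_nat_0_less_iff zero_less_Suc zero_less_divide_1_iff)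
    have cz: "continuous_on (closure D) z" and zF: "\<And>x. x \<in> ?F \<Longrightarrow> z x \<le> 0"
      using z(1) unfolding strip_subsolution_def by auto
    obtain y where y: "y \<in> closure D" "\<And>x. x \<in> closure D \<Longrightarrow> z x \<le> z y"
      using continuous_attains_sup[OF comp _ cz] ne by auto
    have "z y > 0"
      using y(2)[of x] z closure_subset by force
    moreover have "y \<in> D"
      using zF[of y] \<open>z y > 0\<close> y(1) op by (force simp: frontier_def interior_open)
    ultimately show ?thesis
      using z(1) y(2) closure_subset by blast
  qed
  then obtain x z where xz: "\<And>n. strip_subsolution D lam (1 / real (Suc n)) (z n)" "\<And>n. x n \<in> D"
    "\<And>n. z n (x n) > 0" "\<And>n. \<forall>y\<in>D. z n y \<le> z n (x n)"
    by metis
  have xcl: "\<And>n. x n \<in> closure D" using xz(2) closure_subset by blast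
  obtain l s where l: "l \<in> closure D" "strict_mono s" "(x \<circ> s) \<longlonglongrightarrow> l"
    using comp[unfolded compact_def] xcl by blast
  have inf: "infdist (x n) ?F < 1 / real (Suc n)" for n
    using xz(1,2,3)[of n] unfolding strip_subsolution_def by (meson not_le)
  have "(\<lambda>n. infdist ((x \<circ> s) n) ?F) \<longlonglongrightarrow> infdist l ?F"
    by (intro tendsto_infdist l)
  moreover have "(\<lambda>n. infdist ((x \<circ> s) n) ?F) \<longlonglongrightarrow> 0"
  proof (rule tendsto_sandwich[of "\<lambda>n. 0" _ _ "\<lambda>n. 1 / real (Suc n)"])
    show "\<forall>\<^sub>F n in sequentially. infdist ((x \<circ> s) n) ?F \<le> 1 / real (Suc n)"
    proof (rule always_eventually, rule allI)
      fix n
      have "infdist ((x \<circ> s) n) ?F < 1 / real (Suc (s n))" using inf by simp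
      also have "\<dots> \<le> 1 / real (Suc n)"
        using seq_suble[OF l(2), of n] by (intro divide_left_mono) auto
      finally show "infdist ((x \<circ> s) n) ?F \<le> 1 / real (Suc n)" by simp
    qed
    show "(\<lambda>n. 1 / real (Suc n)) \<longlonglongrightarrow> 0"
      using LIMSEQ_inverse_real_of_nat by (simp add: inverse_eq_divide)
  qed (auto simp: infdist_nonneg)
  ultimately have "infdist l ?F = 0"
    using LIMSEQ_unique by blast
  then have lF: "l \<in> ?F"
    using in_closed_iff_infdist_zero[OF frontier_closed Fne] by blast
  obtain \<delta> where \<delta>: "\<delta> > 0"
    "\<And>\<delta>' z x0. \<delta>' \<le> \<delta> \<Longrightarrow> strip_subsolution D lam \<delta>' z \<Longrightarrow> x0 \<in> D \<Longrightarrow> z x0 > 0 \<Longrightarrow>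
       (\<forall>x\<in>D. z x \<le> z x0) \<Longrightarrow> dist x0 l \<ge> \<delta>"
    using strip_subsolution_max_away[OF op sb lF lam] by metis
  obtain N1 where N1: "\<And>n. n \<ge> N1 \<Longrightarrow> dist ((x \<circ> s) n) l < \<delta>"
    using l(3) \<delta>(1) unfolding lim_sequentially by blast
  obtain N2 where N2: "1 / real (Suc N2) < \<delta>"
    using \<delta>(1) nat_approx_posE by blast
  \<comment> \<open>Large enough both for the point to be within \<open>\<delta>\<close> of
    \<open>l\<close> and for the strip to be thinner than \<open>\<delta>\<close>.\<close>
  let ?n = "s (max N1 N2)"
  have "1 / real (Suc ?n) \<le> 1 / real (Suc N2)"
    using seq_suble[OF l(2), of "max N1 N2"] by (intro divide_left_mono) auto
  then have "dist (x ?n) l \<ge> \<delta>"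
    using \<delta>(2)[OF _ xz(1,2,3,4)] N2 by simp
  then show False
    using N1[of "max N1 N2"] by simp
qed

section \<open>Strong minimum principle\<close>

text \<open>With \<open>a = q - y\<close> and \<open>b = x - y\<close>, the ball with diameter from
  \<open>y\<close> to \<open>x\<close> is \<open>|a|\<^sup>2 \<le> a \<bullet> b\<close>. Together
  with \<open>|b| \<le> |a|\<close> this makes \<open>|a - b|\<^sup>2\<close> nonpositive.\<close>

lemma cball_midpoint_touches_sphere_once:
  fixes x y q :: "'a::real_inner"
  assumes "norm (q - y) \<ge> norm (x - y)" "norm (q - midpoint x y) \<le> norm (x - y) / 2"
  shows "q = x"
proof -
  define a where "a = q - y"
  define b where "b = x - y"
  have m: "q - midpoint x y = a - (1/2) *\<^sub>R b"
    by (simp add: a_def b_def midpoint_def algebra_simps) (simp flip: scaleR_add_left)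
  have "(norm (a - (1/2) *\<^sub>R b))\<^sup>2 \<le> (norm b / 2)\<^sup>2"
    using assms(2) unfolding m b_def by (intro power_mono) auto
  then have 1: "(norm a)\<^sup>2 \<le> a \<bullet> b"
    unfolding power2_norm_eq_inner power_divide
    by (simp add: inner_simps inner_commute[of b a] field_simps del: dot_square_norm)
  have "norm b \<le> norm a" using assms(1) by (simp add: a_def b_def)
  then have 2: "(norm b)\<^sup>2 \<le> (norm a)\<^sup>2" by (intro power_mono) auto
  have "(norm (a - b))\<^sup>2 = (norm a)\<^sup>2 + (norm b)\<^sup>2 - 2 * (a \<bullet> b)"
    unfolding power2_norm_eq_inner by (simp add: inner_simps inner_commute[of b a] del: dot_square_norm)
  then have "(norm (a - b))\<^sup>2 \<le> 0" using 1 2 by linarith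
  then show ?thesis by (simp add: a_def b_def)
qed

text \<open>
  At a zero \<open>x1\<close> that is the only one in a closed ball around \<open>c\<close> having \<open>x1\<close> on its sphere, compare
  with the Gaussian \<open>exp (- \<alpha> |x - c|\<^sup>2)\<close> on a small ball around \<open>x1\<close> (not on an annulus around
  \<open>c\<close>, as is customary); this gives a contradiction without looking at the gradient of \<open>z\<close> at \<open>x1\<close>.
\<close>

lemma strong_minimum_principle:
  fixes D :: "'a::euclidean_space set"
  assumes D: "open D" "connected D" and cz: "continuous_on D z"
    and z12: "has_second_partials D z z1 z2"
    and pos: "\<And>x. x \<in> D \<Longrightarrow> z x \<ge> 0"
    and lap: "\<And>x. x \<in> D \<Longrightarrow> (\<Sum>b\<in>Basis. z2 b x) \<le> C * z x" and C: "C \<ge> 0"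
    and zero: "x0 \<in> D" "z x0 = 0"
    and x: "x \<in> D"
  shows "z x = 0"
proof (rule ccontr)
  assume nz: "z x \<noteq> 0"
  define P where "P = {x\<in>D. z x > 0}"
  define Z where "Z = {x\<in>D. z x = 0}"
  have "P = D \<inter> z -` {0<..}" by (auto simp: P_def)
  then have oP: "open P"
    using continuous_open_preimage[OF cz D(1), of "{0<..}"] by simp
  \<comment> \<open>Otherwise \<open>P\<close> and \<open>Z\<close> would disconnect
    \<open>D\<close>. Hence some zero has points with \<open>z > 0\<close> arbitrarily near.\<close>
  have "\<not> open Z"
  proof
    assume "open Z"
    moreover have "P \<inter> D \<noteq> {}" "Z \<inter> D \<noteq> {}" "D \<subseteq> P \<union> Z" "P \<inter> Z \<inter> D = {}"
      using nz x zero pos by (force simp: P_def Z_def)+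
    ultimately show False
      using connectedD[OF D(2) oP] by blast
  qed
  then obtain xz where xz: "xz \<in> Z" "\<And>e. e > 0 \<Longrightarrow> \<not> ball xz e \<subseteq> Z"
    using open_contains_ball by metis
  obtain e0 where e0: "e0 > 0" "cball xz e0 \<subseteq> D"
    using D(1) xz(1) open_contains_cball unfolding Z_def by blast
  define e where "e = e0 / 2"
  have e: "e > 0" "cball xz (2 * e) \<subseteq> D" using e0 by (auto simp: e_def)
  obtain y where y: "y \<in> ball xz e" "y \<notin> Z" using xz(2)[OF e(1)] by blast
  \<comment> \<open>Since \<open>y\<close> is within \<open>e\<close> of the zero \<open>xz\<close>,
    its nearest zero \<open>x1\<close> is also less than \<open>e\<close> away and so lies in the
    open ball of radius \<open>2 * e\<close>.\<close>
  define ZB where "ZB = {q \<in> cball xz (2 * e). z q = 0}"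
  have "ZB = cball xz (2 * e) \<inter> z -` {0}" by (auto simp: ZB_def)
  then have cZB: "closed ZB"
    using continuous_closed_preimage[OF continuous_on_subset[OF cz e(2)], of "{0}"] by simp
  have xzZB: "xz \<in> ZB" using xz(1) e by (simp add: ZB_def Z_def)
  then obtain x1 where x1: "x1 \<in> ZB" "infdist y ZB = dist y x1"
    using infdist_attains_inf[OF cZB] by blast
  define R where "R = norm (x1 - y)"
  have R: "\<And>q. q \<in> ZB \<Longrightarrow> R \<le> norm (q - y)"
    using infdist_le[of _ ZB y] x1 by (simp add: R_def dist_norm norm_minus_commute)
  have "R < e"
    using R[OF xzZB] y(1) by (simp add: dist_norm)
  have yD: "y \<in> D" using y(1) e by (auto simp: subset_eq)
  have zy: "z y \<noteq> 0" using y(2) yD by (simp add: Z_def)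
  have Rpos: "R > 0" using zy x1(1) by (auto simp: R_def ZB_def)
  have "dist xz x1 \<le> dist xz y + dist y x1" by (rule dist_triangle)
  then have "dist xz x1 < 2 * e"
    using y(1) \<open>R < e\<close> by (simp add: R_def dist_norm norm_minus_commute)
  then have x1b: "x1 \<in> ball xz (2 * e)" by simp
  define c where "c = midpoint x1 y"
  have c: "norm (x1 - c) = R / 2"
    using dist_midpoint(1)[of x1 y] by (simp add: c_def R_def dist_norm)
  have touch: "q = x1" if "q \<in> ZB" "norm (q - c) \<le> R / 2" for q
    using cball_midpoint_touches_sphere_once[of x1 y q] R[OF that(1)] that(2)
    by (simp add: R_def c_def)
  obtain r0 where r0: "r0 > 0" "ball x1 r0 \<subseteq> ball xz (2 * e)"
    using x1b open_ball open_contains_ball by blast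
  \<comment> \<open>With \<open>r \<le> R / 4\<close> the small ball stays at distance at least
    \<open>R / 4\<close> from \<open>c\<close>; inside the ball of radius \<open>2 * e\<close>, all
    its zeros belong to \<open>ZB\<close>.\<close>
  define r where "r = min (r0 / 2) (R / 4)"
  have r: "r > 0" "r \<le> R / 4" "cball x1 r \<subseteq> ball xz (2 * e)"
    using r0 Rpos by (auto simp: r_def subset_eq)
  have rD: "cball x1 r \<subseteq> D" using r(3) e(2) by (meson ball_subset_cball order_trans)
  define d where "d = real DIM('a)"
  have d: "d \<ge> 1" by (simp add: d_def Suc_leI)
  \<comment> \<open>The factor \<open>1 + 1 / R\<^sup>2\<close> gives both
    \<open>\<alpha> \<ge> 1\<close> and \<open>\<alpha> * R\<^sup>2 / 4 \<ge> 8 * d + C + 1\<close>.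
    At distance at least \<open>R / 4\<close> from \<open>c\<close> the Laplacian of the Gaussian
    then exceeds \<open>C\<close> times the Gaussian.\<close>
  define \<alpha> where "\<alpha> = (8 * d + C + 1) * (4 * (1 + 1 / R\<^sup>2))"
  have \<alpha>: "\<alpha> > 0" "\<alpha> * (\<alpha> * R\<^sup>2 / 4 - 2 * d) > C"
  proof -
    have k: "8 * d + C + 1 > 1" using d C by simp
    have "1 * 1 \<le> (8 * d + C + 1) * (4 * (1 + 1 / R\<^sup>2))"
      using k by (intro mult_mono) auto
    then have a1: "\<alpha> \<ge> 1" by (simp add: \<alpha>_def)
    then show "\<alpha> > 0" by simp
    have "\<alpha> * R\<^sup>2 / 4 = (8 * d + C + 1) * (R\<^sup>2 + 1)"
      using Rpos by (simp add: \<alpha>_def field_simps)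
    also have "\<dots> \<ge> (8 * d + C + 1) * 1"
      using k by (intro mult_left_mono) auto
    finally have "\<alpha> * R\<^sup>2 / 4 - 2 * d \<ge> C + 1" using d by simp
    then have "1 * (C + 1) \<le> \<alpha> * (\<alpha> * R\<^sup>2 / 4 - 2 * d)"
      using a1 C by (intro mult_mono) auto
    then show "\<alpha> * (\<alpha> * R\<^sup>2 / 4 - 2 * d) > C" by simp
  qed
  let ?E = "\<lambda>x. exp (- \<alpha> * (norm (x - c))\<^sup>2)"
  \<comment> \<open>The value of the Gaussian on the sphere of radius \<open>R / 2\<close> around
    \<open>c\<close>, which contains \<open>x1\<close>. Thus \<open>h\<close> below vanishes at
    \<open>x1\<close> and is negative outside that sphere.\<close>
  define Q where "Q = exp (- \<alpha> * (R / 2)\<^sup>2)"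
  have Q: "Q > 0" by (simp add: Q_def)
  define A where "A = sphere x1 r \<inter> cball c (R / 2)"
  have Ac: "compact A" unfolding A_def by (intro compact_Int compact_sphere compact_cball)
  have AD: "A \<subseteq> D" using rD by (auto simp: A_def)
  have zA: "z q > 0" if q: "q \<in> A" for q
  proof -
    have "q \<noteq> x1" using q r by (auto simp: A_def)
    then have "q \<notin> ZB" using touch[of q] q by (auto simp: A_def dist_norm norm_minus_commute)
    moreover have "q \<in> cball xz (2 * e)"
      using q r(3) ball_subset_cball by (fastforce simp: A_def)
    ultimately show ?thesis using pos[of q] AD q by (auto simp: ZB_def)
  qed
  obtain \<eta> where \<eta>: "\<eta> > 0" "\<And>q. q \<in> A \<Longrightarrow> z q \<ge> \<eta>"
  proof (cases "A = {}")
    case True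
    then show ?thesis using that[of 1] by simp
  next
    case False
    then obtain qm where "qm \<in> A" "\<And>q. q \<in> A \<Longrightarrow> z qm \<le> z q"
      using continuous_attains_inf[OF Ac _ continuous_on_subset[OF cz AD]] by blast
    then show ?thesis using that zA by blast
  qed
  \<comment> \<open>Since the Gaussian is at most \<open>1\<close> and \<open>Q > 0\<close>, this
    keeps \<open>h\<close> below \<open>\<eta> / 2\<close>.\<close>
  define k where "k = \<eta> / 2"
  have k: "k > 0" using \<eta> by (simp add: k_def)
  define h where "h = (\<lambda>x. k * (?E x - Q))"
  have h12: "has_second_partials S h (\<lambda>b x. k * (?E x * (- \<alpha> * (2 * ((x - c) \<bullet> b)))))
    (\<lambda>b x. k * (?E x * (4 * \<alpha>\<^sup>2 * ((x - c) \<bullet> b)\<^sup>2 - 2 * \<alpha>)))" for S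
    unfolding h_def by (rule gaussian_second_partials)
  have ch: "continuous_on S h" for S
    unfolding h_def by (intro continuous_intros)
  have czh: "continuous_on (cball x1 r) (\<lambda>x. z x - h x)"
    by (intro continuous_on_diff continuous_on_subset[OF cz rD] ch)
  obtain q where q: "q \<in> cball x1 r" "\<And>y. y \<in> cball x1 r \<Longrightarrow> z q - h q \<le> z y - h y"
    using continuous_attains_inf[OF compact_cball _ czh] r by auto
  have "h x1 = 0" by (simp add: h_def Q_def c)
  moreover have "z x1 = 0" using x1 by (simp add: ZB_def)
  ultimately have zh: "z q \<le> h q" using q(2)[of x1] r by simp
  have qD: "q \<in> D" using q(1) rD by blast
  \<comment> \<open>On the small sphere, \<open>h q \<ge> z q \<ge> 0\<close> would put
    \<open>q\<close> into \<open>A\<close>, where \<open>z \<ge> \<eta>\<close> exceeds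
    \<open>h\<close>.\<close>
  have "norm (x1 - q) \<noteq> r"
  proof
    assume nr: "norm (x1 - q) = r"
    have hq: "h q \<ge> 0" using zh pos[OF qD] by linarith
    then have "Q \<le> ?E q" using k by (simp add: h_def zero_le_mult_iff)
    then have "(norm (q - c))\<^sup>2 \<le> (R / 2)\<^sup>2" using \<alpha>(1) by (simp add: Q_def)
    then have "norm (q - c) \<le> R / 2" using Rpos by (simp add: power2_le_iff_abs_le)
    then have "q \<in> A" using nr by (simp add: A_def dist_norm norm_minus_commute)
    then have "\<eta> \<le> h q" using \<eta>(2)[of q] zh by linarith
    also have "h q < k * 1"
      unfolding h_def using k Q \<alpha>(1) by (intro mult_strict_left_mono) (auto intro: less_le_trans[of _ "?E q"])
    finally show False using \<eta>(1) by (simp add: k_def)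
  qed
  then have qb: "q \<in> ball x1 r" using q(1) by (simp add: dist_norm)
  have sub: "ball x1 r \<subseteq> D" using rD by (meson ball_subset_cball order_trans)
  have "(\<Sum>b\<in>Basis. k * (?E q * (4 * \<alpha>\<^sup>2 * ((q - c) \<bullet> b)\<^sup>2 - 2 * \<alpha>))) =
      k * (?E q * (4 * \<alpha>\<^sup>2 * (\<Sum>b\<in>Basis. ((q - c) \<bullet> b)\<^sup>2) - (\<Sum>b\<in>(Basis :: 'a set). 2 * \<alpha>)))"
    by (simp only: sum_distrib_left[symmetric] sum_subtractf)
  then have sum: "(\<Sum>b\<in>Basis. k * (?E q * (4 * \<alpha>\<^sup>2 * ((q - c) \<bullet> b)\<^sup>2 - 2 * \<alpha>))) =
      k * ?E q * (4 * \<alpha>\<^sup>2 * (norm (q - c))\<^sup>2 - 2 * \<alpha> * d)"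
    by (simp only: sum_inner_Basis_square) (simp add: d_def)
  have qmax: "h y - z y \<le> h q - z q" if "y \<in> ball x1 r" for y
    using q(2)[of y] that by simp
  \<comment> \<open>At the interior maximum of \<open>h - z\<close> the Laplacians compare.
    Replacing \<open>h q\<close> by the larger \<open>k * ?E q\<close> lets the common positive
    factor cancel.\<close>
  have "(\<Sum>b\<in>Basis. k * (?E q * (4 * \<alpha>\<^sup>2 * ((q - c) \<bullet> b)\<^sup>2 - 2 * \<alpha>))) \<le> (\<Sum>b\<in>Basis. z2 b q)"
    by (rule second_partials_sum_le_at_max[OF h12 has_second_partials_subset[OF z12 sub] open_ball qb qmax])
  also have "\<dots> \<le> C * z q" using lap[OF qD] .
  also have "\<dots> \<le> C * h q" using zh C by (rule mult_left_mono)
  also have "\<dots> \<le> C * (k * ?E q)"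
    unfolding h_def using C k Q by (intro mult_left_mono) auto
  finally have kle: "k * ?E q * (4 * \<alpha>\<^sup>2 * (norm (q - c))\<^sup>2 - 2 * \<alpha> * d) \<le> k * ?E q * C"
    unfolding sum by (simp only: ac_simps)
  have "k * ?E q > 0" using k by simp
  then have le: "4 * \<alpha>\<^sup>2 * (norm (q - c))\<^sup>2 - 2 * \<alpha> * d \<le> C"
    using kle by (simp only: mult_le_cancel_left_pos)
  have "R / 2 \<le> norm (x1 - q) + norm (q - c)"
    using norm_triangle_ineq[of "x1 - q" "q - c"] c by simp
  then have "R / 4 \<le> norm (q - c)" using qb r(2) by (simp add: dist_norm)
  then have "(R / 4)\<^sup>2 \<le> (norm (q - c))\<^sup>2" using Rpos by (intro power_mono) auto
  then have "4 * \<alpha>\<^sup>2 * (R / 4)\<^sup>2 \<le> 4 * \<alpha>\<^sup>2 * (norm (q - c))\<^sup>2"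
    by (intro mult_left_mono) auto
  then have "\<alpha> * (\<alpha> * R\<^sup>2 / 4 - 2 * d) \<le> C"
    using le by (simp add: power2_eq_square algebra_simps)
  then show False using \<alpha>(2) by simp
qed

section \<open>Estimates for the nonlinearity\<close>

text \<open>The right-hand side of the equation solved for the Laplacian.\<close>

definition nonlinearity :: "real \<Rightarrow> real \<Rightarrow> real \<Rightarrow> real" where
  "nonlinearity p lam s = s powr (p - 1) - lam * s"

lemma nonlinearity_factor:
  assumes "s > 0"
  shows "nonlinearity p lam s = (s powr (p - 2) - lam) * s"
proof -
  have "s powr (p - 1) = s powr (p - 2) * s powr 1"
    by (simp only: powr_add[symmetric]) simp
  then show ?thesis
    using assms by (simp add: nonlinearity_def algebra_simps)
qed

text \<open>The quotient of the nonlinearity by its argument, \<open>s powr (p - 2) - lam\<close>,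
  is nondecreasing for \<open>p \<ge> 2\<close>. So multiples \<open>t v\<close> with
  \<open>t \<ge> 1\<close> are supersolutions.\<close>

lemma nonlinearity_mult_le:
  assumes "p \<ge> 2" "s > 0" "t \<ge> 1"
  shows "t * nonlinearity p lam s \<le> nonlinearity p lam (t * s)"
proof -
  have "s powr (p - 2) \<le> (t * s) powr (p - 2)"
    using assms by (intro powr_mono2) auto
  then have "(s powr (p - 2) - lam) * (t * s) \<le> ((t * s) powr (p - 2) - lam) * (t * s)"
    using assms by (intro mult_right_mono) auto
  then show ?thesis
    using assms by (simp add: nonlinearity_factor)
qed

lemma nonlinearity_diff_ge:
  assumes "p \<ge> 2" "0 < r" "r \<le> s"
  shows "nonlinearity p lam s - nonlinearity p lam r \<ge> - lam * (s - r)"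
proof -
  have "r powr (p - 1) \<le> s powr (p - 1)"
    using assms by (intro powr_mono2) auto
  then show ?thesis
    by (simp add: nonlinearity_def algebra_simps)
qed

text \<open>Mean value theorem for the power; the linear term only lowers the difference. The
  constant depends on the upper bound \<open>S\<close> alone and does not degenerate as
  \<open>r\<close> tends to \<open>0\<close>.\<close>

lemma nonlinearity_diff_le:
  assumes "p \<ge> 2" "lam \<ge> 0" "0 < r" "r \<le> s" "s \<le> S"
  shows "nonlinearity p lam s - nonlinearity p lam r \<le> (p - 1) * S powr (p - 2) * (s - r)"
proof (cases "r = s")
  case False
  then have rs: "r < s" using assms by simp
  have "((\<lambda>x. x powr (p - 1)) has_real_derivative (p - 1) * x powr (p - 2)) (at x)" if "r \<le> x" for x
    using has_real_derivative_powr[of x "p - 1"] that assms(3) by simp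
  then obtain x where x: "r < x" "x < s"
    "s powr (p - 1) - r powr (p - 1) = (s - r) * ((p - 1) * x powr (p - 2))"
    using MVT2[OF rs, of "\<lambda>x. x powr (p - 1)" "\<lambda>x. (p - 1) * x powr (p - 2)"] by blast
  have "x powr (p - 2) \<le> S powr (p - 2)"
    using x assms by (intro powr_mono2) auto
  then have "(s - r) * ((p - 1) * x powr (p - 2)) \<le> (s - r) * ((p - 1) * S powr (p - 2))"
    using rs assms(1) by (intro mult_left_mono) auto
  moreover have "lam * r \<le> lam * s"
    using assms by (intro mult_left_mono) auto
  ultimately show ?thesis
    using x(3) by (simp add: nonlinearity_def algebra_simps)
qed simp

section \<open>Comparison of two solutions\<close>

lemma positive_classical_solutionD:
  assumes "positive_classical_solution D p lam u"
  shows "has_second_partials D u (\<lambda>b. partial b u) (\<lambda>b. partial b (partial b u))"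
    and "continuous_on (closure D) u"
    and "x \<in> D \<Longrightarrow> (\<Sum>b\<in>Basis. partial b (partial b u) x) = nonlinearity p lam (u x)"
    and "x \<in> D \<Longrightarrow> u x > 0"
    and "x \<in> frontier D \<Longrightarrow> u x = 0"
    and "(LINT x:D|lborel. \<bar>u x\<bar>\<^sup>2) = 1"
proof -
  show "x \<in> D \<Longrightarrow> (\<Sum>b\<in>Basis. partial b (partial b u) x) = nonlinearity p lam (u x)"
    using assms unfolding positive_classical_solution_def laplacian_def nonlinearity_def by fastforce
qed (use assms C_on_2_has_second_partials in \<open>auto simp: positive_classical_solution_def\<close>)

text \<open>The function \<open>u - t v\<close> is a \<open>strip_subsolution\<close>:
  \<open>t v\<close> is a supersolution, and where \<open>u > t v\<close> the power term has a
  favourable sign. The width is fixed before \<open>t\<close>, which later allows \<open>t\<close>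
  to be decreased.\<close>

lemma multiple_dominates_of_dominates_off_strip:
  assumes p: "p \<ge> 2" and D: "bounded_smooth_domain D" and lam: "lam \<ge> 0"
    and u: "positive_classical_solution D p lam u" and v: "positive_classical_solution D p lam v"
  shows "\<exists>\<delta>>0. \<forall>t\<ge>1. (\<forall>x\<in>D. infdist x (frontier D) \<ge> \<delta> \<longrightarrow> u x \<le> t * v x) \<longrightarrow>
    (\<forall>x\<in>D. u x \<le> t * v x)"
proof -
  note u' = positive_classical_solutionD[OF u]
  note v' = positive_classical_solutionD[OF v]
  obtain \<delta> where \<delta>: "\<delta> > 0"
    "\<And>z x. strip_subsolution D lam \<delta> z \<Longrightarrow> x \<in> D \<Longrightarrow> z x \<le> 0"
    using strip_maximum_principle[OF D lam] by blast
  have "\<forall>x\<in>D. u x \<le> t * v x"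
    if t: "t \<ge> 1" and off: "\<forall>x\<in>D. infdist x (frontier D) \<ge> \<delta> \<longrightarrow> u x \<le> t * v x" for t
  proof -
    have "strip_subsolution D lam \<delta> (\<lambda>x. u x - t * v x)"
      unfolding strip_subsolution_def
    proof (intro conjI exI)
      show "continuous_on (closure D) (\<lambda>x. u x - t * v x)"
        by (intro continuous_intros u' v')
      show "has_second_partials D (\<lambda>x. u x - t * v x)
          (\<lambda>b x. partial b u x - t * partial b v x)
          (\<lambda>b x. partial b (partial b u) x - t * partial b (partial b v) x)"
        by (intro has_second_partials_diff has_second_partials_cmult u' v')
      show "\<forall>x\<in>D. u x - t * v x > 0 \<longrightarrow>
          (\<Sum>b\<in>Basis. partial b (partial b u) x - t * partial b (partial b v) x)
            \<ge> - lam * (u x - t * v x)"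
      proof (intro ballI impI)
        fix x assume x: "x \<in> D" "u x - t * v x > 0"
        have vx: "v x > 0" using v' x by blast
        have "(\<Sum>b\<in>Basis. partial b (partial b u) x - t * partial b (partial b v) x) =
            nonlinearity p lam (u x) - t * nonlinearity p lam (v x)"
          using u'(3)[OF x(1)] v'(3)[OF x(1)]
          by (simp add: sum_subtractf sum_distrib_left[symmetric])
        also have "\<dots> \<ge> nonlinearity p lam (u x) - nonlinearity p lam (t * v x)"
          using nonlinearity_mult_le[OF p vx t, of lam] by simp
        also have "nonlinearity p lam (u x) - nonlinearity p lam (t * v x) \<ge> - lam * (u x - t * v x)"
          using x vx t p by (intro nonlinearity_diff_ge) auto
        finally show "(\<Sum>b\<in>Basis. partial b (partial b u) x - t * partial b (partial b v) x)
            \<ge> - lam * (u x - t * v x)" .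
      qed
    qed (use off u'(5) v'(5) in auto)
    then show ?thesis using \<delta>(2) by fastforce
  qed
  then show ?thesis using \<delta>(1) by blast
qed

lemma positive_classical_solution_le:
  fixes D :: "'a::euclidean_space set"
  assumes p: "p \<ge> 2" and D: "bounded_smooth_domain D" and lam: "lam \<ge> 0"
    and u: "positive_classical_solution D p lam u" and v: "positive_classical_solution D p lam v"
    and x: "x \<in> D"
  shows "u x \<le> v x"
proof -
  note u' = positive_classical_solutionD[OF u]
  note v' = positive_classical_solutionD[OF v]
  have op: "open D" and con: "connected D" and bd: "bounded D" and ne: "D \<noteq> {}"
    using D by (auto simp: bounded_smooth_domain_def)
  have Dcl: "D \<subseteq> closure D" by (rule closure_subset)
  have comp: "compact (closure D)" using bd by (simp add: compact_closure)
  obtain \<delta> where \<delta>: "\<delta> > 0"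
    "\<forall>t\<ge>1. (\<forall>x\<in>D. infdist x (frontier D) \<ge> \<delta> \<longrightarrow> u x \<le> t * v x) \<longrightarrow>
      (\<forall>x\<in>D. u x \<le> t * v x)"
    using multiple_dominates_of_dominates_off_strip[OF p D lam u v] by blast
  define A where "A = closure D \<inter> {x. infdist x (frontier D) \<ge> \<delta>}"
  have Ac: "compact A"
    unfolding A_def by (intro compact_Int_closed comp closed_Collect_le continuous_on_infdist
        continuous_on_id continuous_on_const)
  have AD: "A \<subseteq> D"
  proof
    fix a assume a: "a \<in> A"
    then have "a \<notin> frontier D" using \<delta>(1) by (force simp: A_def)
    then show "a \<in> D" using a op by (auto simp: A_def frontier_def interior_open)
  qed
  have DA: "a \<in> A" if "a \<in> D" "infdist a (frontier D) \<ge> \<delta>" for a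
    using that Dcl by (auto simp: A_def)
  \<comment> \<open>The set \<open>A\<close> may be empty if \<open>\<delta>\<close> is large; any
    positive bound then serves.\<close>
  have lower: "\<exists>m>0. \<forall>x\<in>A. m \<le> f x" if f: "continuous_on D f" "\<And>x. x \<in> D \<Longrightarrow> f x > 0" for f :: "'a \<Rightarrow> real"
  proof (cases "A = {}")
    case False
    then obtain a where "a \<in> A" "\<And>y. y \<in> A \<Longrightarrow> f a \<le> f y"
      using continuous_attains_inf[OF Ac _ continuous_on_subset[OF f(1) AD]] by blast
    then show ?thesis using f AD by blast
  qed (auto intro: exI[of _ 1])
  have upper: "\<exists>M>0. \<forall>x\<in>D. f x \<le> M" if f: "continuous_on (closure D) f" for f :: "'a \<Rightarrow> real"
  proof -
    obtain a where a: "\<And>y. y \<in> closure D \<Longrightarrow> f y \<le> f a"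
      using continuous_attains_sup[OF comp _ f] ne by auto
    have "f y \<le> max 1 (f a)" if "y \<in> D" for y
      using a[of y] that Dcl by auto
    then show ?thesis by (intro exI[of _ "max 1 (f a)"]) auto
  qed
  obtain m where m: "m > 0" "\<And>x. x \<in> A \<Longrightarrow> m \<le> v x"
    using lower[of v] v'(2,4) Dcl continuous_on_subset by meson
  obtain Mu where Mu: "Mu > 0" "\<And>x. x \<in> D \<Longrightarrow> u x \<le> Mu"
    using upper[OF u'(2)] by blast
  obtain Mv where Mv: "Mv > 0" "\<And>x. x \<in> D \<Longrightarrow> v x \<le> Mv"
    using upper[OF v'(2)] by blast
  define T where "T = {t. t \<ge> 1 \<and> (\<forall>x\<in>D. u x \<le> t * v x)}"
  have T: "t \<in> T"
    if "t \<ge> 1" "\<And>a. a \<in> D \<Longrightarrow> infdist a (frontier D) \<ge> \<delta> \<Longrightarrow> u a \<le> t * v a" for t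
    using \<delta>(2) that by (simp add: T_def)
  \<comment> \<open>Off the strip \<open>u \<le> Mu\<close> and \<open>v \<ge> m\<close>, and
    \<open>T\<close> extends the inequality to the strip.\<close>
  have "max 1 (Mu / m) \<in> T"
  proof (rule T)
    fix a assume a: "a \<in> D" "infdist a (frontier D) \<ge> \<delta>"
    have "u a \<le> Mu" using Mu a by blast
    also have "Mu = Mu / m * m" using m by simp
    also have "\<dots> \<le> max 1 (Mu / m) * v a"
      using m(1) m(2)[OF DA[OF a]] by (intro mult_mono) auto
    finally show "u a \<le> max 1 (Mu / m) * v a" .
  qed auto
  then have Tne: "T \<noteq> {}" by blast
  have Tbd: "bdd_below T" unfolding T_def by (rule bdd_belowI[of _ 1]) simp
  define t where "t = Inf T"
  have t1: "t \<ge> 1"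
    unfolding t_def using Tne by (intro cInf_greatest) (auto simp: T_def)
  \<comment> \<open>The infimum is itself admissible, because \<open>u y / v y\<close> is a lower
    bound of \<open>T\<close> for each \<open>y\<close>.\<close>
  have ut: "u y \<le> t * v y" if y: "y \<in> D" for y
  proof -
    have vy: "v y > 0" using v' y by blast
    have "u y / v y \<le> t"
      unfolding t_def using Tne vy y
      by (intro cInf_greatest) (auto simp: T_def field_simps)
    then show ?thesis using vy by (simp add: field_simps)
  qed
  define z where "z = (\<lambda>x. t * v x - u x)"
  have z12: "has_second_partials D z (\<lambda>b x. t * partial b v x - partial b u x)
      (\<lambda>b x. t * partial b (partial b v) x - partial b (partial b u) x)"
    unfolding z_def by (intro has_second_partials_diff has_second_partials_cmult u' v')
  have cz: "continuous_on D z"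
    unfolding z_def by (intro continuous_intros continuous_on_subset[OF u'(2) Dcl] continuous_on_subset[OF v'(2) Dcl])
  \<comment> \<open>The constant of \<open>nonlinearity_diff_le\<close> with the upper bound
    \<open>t * Mv\<close> for \<open>t * v\<close>.\<close>
  define C where "C = (p - 1) * (t * Mv) powr (p - 2)"
  have C: "C \<ge> 0" using p by (simp add: C_def)
  have lapz: "(\<Sum>b\<in>Basis. t * partial b (partial b v) y - partial b (partial b u) y) \<le> C * z y"
    if y: "y \<in> D" for y
  proof -
    have "(\<Sum>b\<in>Basis. t * partial b (partial b v) y - partial b (partial b u) y) =
        t * nonlinearity p lam (v y) - nonlinearity p lam (u y)"
      using u'(3)[OF y] v'(3)[OF y] by (simp add: sum_subtractf sum_distrib_left[symmetric])
    also have "\<dots> \<le> nonlinearity p lam (t * v y) - nonlinearity p lam (u y)"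
      using nonlinearity_mult_le[OF p v'(4)[OF y] t1, of lam] by simp
    also have "\<dots> \<le> C * z y"
      unfolding C_def z_def using p lam ut y u'(4) Mv t1
      by (intro nonlinearity_diff_le) auto
    finally show ?thesis .
  qed
  have "t = 1"
  proof (cases "\<exists>x0\<in>D. z x0 = 0")
    case True
    then obtain x0 where x0: "x0 \<in> D" "z x0 = 0" by blast
    have eq: "u y = t * v y" if "y \<in> D" for y
      using strong_minimum_principle[OF op con cz z12 _ lapz C x0 that] ut by (simp add: z_def)
    have "(LINT x:D|lborel. \<bar>u x\<bar>\<^sup>2) = (LINT x:D|lborel. t\<^sup>2 * \<bar>v x\<bar>\<^sup>2)"
      using op eq by (intro set_lebesgue_integral_cong) (auto simp: power_mult_distrib)
    then have "1 = t\<^sup>2"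
      using u'(6) v'(6) by simp
    then show ?thesis
      using t1 by (simp add: power2_eq_1_iff)
  next
    case False
    then have zpos: "z y > 0" if "y \<in> D" for y
      using ut[OF that] that unfolding z_def by force
    obtain \<eta> where \<eta>: "\<eta> > 0" "\<And>y. y \<in> A \<Longrightarrow> \<eta> \<le> z y"
      using lower[OF cz zpos] by blast
    \<comment> \<open>Lowering \<open>t\<close> by \<open>\<eta> / Mv\<close> costs at most
      \<open>\<eta>\<close> on \<open>A\<close>, as \<open>v \<le> Mv\<close>. Minimality of
      \<open>t\<close> then leaves only \<open>s = 1\<close>.\<close>
    define s where "s = max 1 (t - \<eta> / Mv)"
    have "s \<in> T"
    proof (rule T)
      fix a assume a: "a \<in> D" "infdist a (frontier D) \<ge> \<delta>"
      have va: "0 < v a" "v a \<le> Mv" using v'(4) Mv a by auto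
      have "\<eta> / Mv * v a \<le> \<eta> / Mv * Mv"
        using va \<eta>(1) Mv(1) by (intro mult_left_mono) auto
      then have "\<eta> / Mv * v a \<le> \<eta>" using Mv(1) by simp
      then have "u a \<le> (t - \<eta> / Mv) * v a"
        using \<eta>(2)[OF DA[OF a]] by (simp add: z_def algebra_simps)
      also have "\<dots> \<le> s * v a" using va by (intro mult_right_mono) (auto simp: s_def)
      finally show "u a \<le> s * v a" .
    qed (auto simp: s_def)
    then have "t \<le> s" unfolding t_def using Tbd by (rule cInf_lower)
    moreover have "\<eta> / Mv > 0" using \<eta>(1) Mv(1) by simp
    ultimately show ?thesis using t1 by (auto simp: s_def max_def split: if_splits)
  qed
  then show ?thesis using ut[OF x] by simp
qed

theorem proposition5p11:
  fixes D :: "'a::euclidean_space set" and p lam :: real and u v :: "'a \<Rightarrow> real"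
  assumes "2 \<le> p" and "bounded_smooth_domain D" and "0 < lam"
    and "positive_classical_solution D p lam u"
    and "positive_classical_solution D p lam v"
  shows "\<forall>x\<in>closure D. u x = v x"
proof
  fix x assume x: "x \<in> closure D"
  have lam: "lam \<ge> 0" using assms(3) by simp
  show "u x = v x"
  proof (cases "x \<in> D")
    case True
    then show ?thesis
      using positive_classical_solution_le[OF assms(1,2) lam assms(4,5)]
        positive_classical_solution_le[OF assms(1,2) lam assms(5,4)] by (simp add: order_antisym)
  next
    case False
    then have "x \<in> frontier D"
      using x interior_subset by (auto simp: frontier_def)
    then show ?thesis
      using assms(4,5) by (simp add: positive_classical_solution_def)
  qed
qed

end
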